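(* Let $ABC$ be a non-degenerate triangle in the Euclidean plane. Let $A_1$ be the point of side $BC$ such that $AA_1$ bisects the interior angle $\angle CAB$, and let $B_1$ be the point of side $AC$ such that $BB_1$ bisects the interior angle $\angle CBA$. Then $|AA_1| = |BB_1|$ if and only if triangle $ABC$ is isosceles with base $AB$, i.e. if and only if $|AC| = |BC|$.
   Context: $|XY|$ denotes the length of the segment $XY$. The base of the triangle is the side $AB$. *)

theory Defs
  imports "HOL-Analysis.Analysis"
begin

text \<open>
  The unsigned angle at the vertex \<open>Q\<close> between the rays \<open>QP\<close> and \<open>QR\<close>, as a number
  in \<open>[0, pi]\<close>. It is only meaningful for \<open>P \<noteq> Q\<close> and \<open>R \<noteq> Q\<close>
  (otherwise division by zero makes the value \<open>arccos 0 = pi / 2\<close>).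
\<close>
definition angle :: "real ^ 2 \<Rightarrow> real ^ 2 \<Rightarrow> real ^ 2 \<Rightarrow> real" where
  "angle P Q R = arccos (((P - Q) \<bullet> (R - Q)) / (norm (P - Q) * norm (R - Q)))"

text \<open>
  \<open>X\<close> is the foot on the side \<open>QR\<close> of the bisector of the interior angle of the triangle
  \<open>PQR\<close> at the vertex \<open>P\<close>. Since the angles are unsigned, it is the requirement that \<open>X\<close>
  lies on the side \<open>QR\<close> that excludes the exterior bisector.
\<close>
definition bisector_foot :: "real ^ 2 \<Rightarrow> real ^ 2 \<Rightarrow> real ^ 2 \<Rightarrow> real ^ 2 \<Rightarrow> bool" where
  "bisector_foot P Q R X \<longleftrightarrow> X \<in> closed_segment Q R \<and> angle Q P X = angle X P R"

end

theory Submission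
  imports Defs
begin

text \<open>
  The bisector at \<open>A\<close> divides \<open>BC\<close> in the ratio of the adjacent sides, which gives
  \<open>AA1\<^sup>2 = b c (1 - a\<^sup>2 / (b + c)\<^sup>2)\<close>, and symmetrically for \<open>BB1\<close>. Once the common positive
  factor \<open>c (a + b + c)\<close> is cancelled from \<open>AA1\<^sup>2 = BB1\<^sup>2\<close>, the difference of the two sides is
  \<open>a - b\<close> times a polynomial in \<open>a\<close>, \<open>b\<close>, \<open>c\<close> all of whose coefficients have the same sign.
\<close>

text \<open>\<open>arccos\<close> is injective on [-1, 1], and Cauchy-Schwarz puts both quotients
  there. If a vector vanishes, division by zero gives the quotient 0, still in that range.\<close>

lemma angle_eq_iff:
  "angle P Q R = angle P' Q' R' \<longleftrightarrow>
    ((P - Q) \<bullet> (R - Q)) / (norm (P - Q) * norm (R - Q)) =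
    ((P' - Q') \<bullet> (R' - Q')) / (norm (P' - Q') * norm (R' - Q'))"
proof -
  have "\<bar>(x \<bullet> y) / (norm x * norm y)\<bar> \<le> 1" for x y :: "real ^ 2"
    using Cauchy_Schwarz_ineq2[of x y] by (cases "x = 0 \<or> y = 0") (auto simp: abs_mult)
  then show ?thesis
    unfolding angle_def by (metis arccos_eq_iff)
qed

lemma bisector_foot_ratio:
  assumes nc: "\<not> collinear {P, Q, R}" and foot: "bisector_foot P Q R X"
  shows "X - P = (norm (R - P) / (norm (Q - P) + norm (R - P))) *\<^sub>R (Q - P) +
                 (norm (Q - P) / (norm (Q - P) + norm (R - P))) *\<^sub>R (R - P)"
proof -
  define u v x where "u = Q - P" and "v = R - P" and "x = X - P"
  obtain t where "X = (1 - t) *\<^sub>R Q + t *\<^sub>R R"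
    using foot unfolding bisector_foot_def in_segment by blast
  then have x: "x = (1 - t) *\<^sub>R u + t *\<^sub>R v"
    unfolding u_def v_def x_def by (simp add: algebra_simps)
  have "\<not> collinear {0, u, v}"
    using nc collinear_3[of Q P R] unfolding u_def v_def by (simp add: insert_commute)
  then have cs: "\<bar>u \<bullet> v\<bar> \<noteq> norm u * norm v"
    using norm_cauchy_schwarz_equal by blast
  then have u: "norm u > 0" and v: "norm v > 0" by auto
  \<comment> \<open>Allows \<open>norm x\<close> to be cancelled from the equation of cosines below.
    A foot at the vertex \<open>P\<close> would make \<open>u\<close> a multiple of
    \<open>v\<close>.\<close>
  have "x \<noteq> 0"
  proof
    assume "x = 0"
    then have "(1 - t) *\<^sub>R u = (- t) *\<^sub>R v"
      using x by (simp add: add_eq_0_iff)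
    moreover from this have "t \<noteq> 1" using v by auto
    ultimately have "u = (- t / (1 - t)) *\<^sub>R v"
      by (metis divide_inverse_commute eq_vector_fraction_iff right_minus_eq scaleR_scaleR)
    then show False
      using \<open>\<not> collinear {0, u, v}\<close> collinear_lemma[of v u] by (metis insert_commute)
  qed
  moreover have "(u \<bullet> x) / (norm u * norm x) = (x \<bullet> v) / (norm x * norm v)"
    using foot unfolding bisector_foot_def angle_eq_iff u_def v_def x_def by blast
  ultimately have "norm v * (u \<bullet> x) = norm u * (x \<bullet> v)"
    using u v by (simp add: field_simps)
  then have "norm v * ((1 - t) * (norm u)\<^sup>2 + t * (u \<bullet> v)) =
      norm u * ((1 - t) * (u \<bullet> v) + t * (norm v)\<^sup>2)"
    unfolding x by (simp add: inner_add_left inner_add_right power2_norm_eq_inner)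
  \<comment> \<open>Both sides differ by this product. Its second factor is nonzero by strict
    Cauchy-Schwarz for non-collinear vectors, so the first determines \<open>t\<close>.\<close>
  then have "((1 - t) * norm u - t * norm v) * (norm u * norm v - u \<bullet> v) = 0"
    by algebra
  moreover have "norm u * norm v - u \<bullet> v \<noteq> 0" using cs
    by (metis abs_mult abs_norm_cancel right_minus_eq)
  ultimately have "(1 - t) * norm u = t * norm v" by simp
  then have "t * (norm u + norm v) = norm u" "(1 - t) * (norm u + norm v) = norm v"
    by algebra+
  moreover have "norm u + norm v \<noteq> 0" using u v by linarith
  ultimately have "t = norm u / (norm u + norm v)" "1 - t = norm v / (norm u + norm v)"
    by (metis nonzero_eq_divide_eq)+
  then show ?thesis
    using x unfolding u_def v_def x_def by simp
qed

lemma bisector_length: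
  assumes nc: "\<not> collinear {P, Q, R}" and foot: "bisector_foot P Q R X"
  shows "(dist P X)\<^sup>2 * (dist P Q + dist P R)\<^sup>2 =
    dist P Q * dist P R * ((dist P Q + dist P R)\<^sup>2 - (dist Q R)\<^sup>2)"
proof -
  define u v where "u = Q - P" and "v = R - P"
  have "P \<noteq> Q" using nc by auto
  then have s: "norm u + norm v > 0"
    unfolding u_def v_def by (simp add: add_pos_nonneg)
  have "(norm u + norm v) *\<^sub>R (X - P) = norm v *\<^sub>R u + norm u *\<^sub>R v"
    using bisector_foot_ratio[OF assms] s unfolding u_def v_def by (simp add: scaleR_add_right)
  then have "(norm (X - P) * (norm u + norm v))\<^sup>2 = (norm (norm v *\<^sub>R u + norm u *\<^sub>R v))\<^sup>2"
    using s by (metis abs_of_pos mult.commute norm_scaleR)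
  \<comment> \<open>Both summands have the same norm \<open>norm u * norm v\<close>.\<close>
  also have "\<dots> = 2 * (norm u * norm v)\<^sup>2 + 2 * norm u * norm v * (u \<bullet> v)"
    using dot_norm[of "norm v *\<^sub>R u" "norm u *\<^sub>R v"] by (simp add: power_mult_distrib field_simps)
  \<comment> \<open>The law of cosines trades \<open>u \<bullet> v\<close> for the third side
    \<open>norm (u - v)\<close>.\<close>
  also have "\<dots> = norm u * norm v * ((norm u + norm v)\<^sup>2 - (norm (u - v))\<^sup>2)"
    unfolding dot_norm_neg[of u v] by (simp add: power2_eq_square field_simps)
  finally show ?thesis
    unfolding u_def v_def by (simp add: dist_norm norm_minus_commute power_mult_distrib)
qed

text \<open>The algebraic core, with \<open>x\<close> and \<open>y\<close> as the bisectors to the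
  sides \<open>a\<close> and \<open>b\<close>. Nonnegativity lets equal squares give equal
  lengths.\<close>

lemma bisector_length_eq_iff:
  fixes a b c x y :: real
  assumes pos: "a > 0" "b > 0" "c > 0" and nonneg: "x \<ge> 0" "y \<ge> 0"
    and x: "x\<^sup>2 * (b + c)\<^sup>2 = b * c * ((b + c)\<^sup>2 - a\<^sup>2)"
    and y: "y\<^sup>2 * (a + c)\<^sup>2 = a * c * ((a + c)\<^sup>2 - b\<^sup>2)"
  shows "x = y \<longleftrightarrow> b = a"
proof
  assume "b = a"
  then have "x\<^sup>2 * (a + c)\<^sup>2 = y\<^sup>2 * (a + c)\<^sup>2" using x y by simp
  then show "x = y" using pos nonneg by simp
next
  assume "x = y"
  \<comment> \<open>Multiplying by both denominators lets the two length formulas be substituted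
    without division.\<close>
  then have "x\<^sup>2 * (b + c)\<^sup>2 * (a + c)\<^sup>2 = y\<^sup>2 * (a + c)\<^sup>2 * (b + c)\<^sup>2"
    by simp
  then have "b * c * ((b + c)\<^sup>2 - a\<^sup>2) * (a + c)\<^sup>2 = a * c * ((a + c)\<^sup>2 - b\<^sup>2) * (b + c)\<^sup>2"
    unfolding x y .
  then have "(a - b) * (c * (a + b + c) * (c ^ 3 + 3 * a * b * c + a * b * (a + b) + c\<^sup>2 * (a + b))) = 0"
    by algebra
  moreover have "c * (a + b + c) * (c ^ 3 + 3 * a * b * c + a * b * (a + b) + c\<^sup>2 * (a + b)) > 0"
    using pos by (intro mult_pos_pos add_pos_pos) auto
  ultimately show "b = a"
    by (metis mult_eq_0_iff less_irrefl right_minus_eq)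
qed

theorem theorem3p9:
  fixes A B C A1 B1 :: "real ^ 2"
  assumes "\<not> collinear {A, B, C}"
    and "bisector_foot A C B A1"
    and "bisector_foot B C A B1"
  shows "dist A A1 = dist B B1 \<longleftrightarrow> dist A C = dist B C"
proof (rule bisector_length_eq_iff)
  have nc: "\<not> collinear {A, C, B}" "\<not> collinear {B, C, A}"
    using assms(1) by (simp_all add: insert_commute)
  \<comment> \<open>The conclusion of \<open>bisector_length_eq_iff\<close> does not mention
    \<open>c\<close>; it is fixed here as \<open>dist A B\<close>.\<close>
  then show "dist B C > 0" "dist A C > 0" "dist A B > 0"
    by (auto simp: insert_commute)
  show "(dist A A1)\<^sup>2 * (dist A C + dist A B)\<^sup>2 =
      dist A C * dist A B * ((dist A C + dist A B)\<^sup>2 - (dist B C)\<^sup>2)"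
    using bisector_length[OF nc(1) assms(2)] by (simp add: dist_commute)
  show "(dist B B1)\<^sup>2 * (dist B C + dist A B)\<^sup>2 =
      dist B C * dist A B * ((dist B C + dist A B)\<^sup>2 - (dist A C)\<^sup>2)"
    using bisector_length[OF nc(2) assms(3)] by (simp add: dist_commute)
qed simp_all

end
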